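(* Let $\rho:G\to[0,\infty)$ be the scalar whitened residual merit $\rho(X_B)=\bigl(\sum_{k=1}^Kr_k(X_B)^\top\Sigma_w^{-1}r_k(X_B)\bigr)^{1/2}$ of a fixed measurement batch. Let $\varepsilon_{\rm acc}\ge0$, and consider the iterative residual-safeguarded refinement algorithm, started at $X_B^{(0)}\in G$, in which each candidate residual is recomputed with the same batch (controls, measurements, noise covariance) used to define $\rho$ and a candidate $X_B^{(t+1)}$ is accepted only if $$\rho(X_B^{(t+1)})\le\rho(X_B^{(t)})-\varepsilon_{\rm acc}.$$ Then every accepted outer iteration satisfies $\rho(X_B^{(t+1)})\le\rho(X_B^{(t)})-\varepsilon_{\rm acc}$. In particular, if $\varepsilon_{\rm acc}=0$, the accepted residual sequence is nonincreasing; if $\varepsilon_{\rm acc}>0$, the number $N_{\rm acc}$ of strict accepted updates is finite and satisfies $$N_{\rm acc}\le\frac{\rho(X_B^{(0)})}{\varepsilon_{\rm acc}}.$$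
   Context: $G=\mathrm{SO}(3)\times\mathbb R^3$. The batch consists of control poses $\mathcal U=\{X_{U,k}\}_{k=1}^K\subset G$, wrench measurements $Y=\{y_k\}_{k=1}^K\subset\mathbb R^6$ and a noise covariance $\Sigma_w\succ0$; $r_k(X_B)=y_k-h_k(X_B)\in\mathbb R^6$, where $h_k:G\to\mathbb R^6$ is the predicted wrench map at control pose $X_{U,k}$ (only the fact that $\rho$ is a well-defined nonnegative function of $X_B$ matters). The algorithm is an outer loop that at iteration $t$ has a current pose $X_B^{(t)}$, generates a finite set of candidate poses by any rule (posterior-induced branches, or a damped residual-descent fallback), keeps only candidates satisfying the acceptance inequality, moves to a retained candidate as $X_B^{(t+1)}$ (an "accepted update"), and terminates if no candidate is retained. $(X_B^{(t)})$ denotes the sequence of accepted poses. *)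

theory Defs
  imports "HOL-Analysis.Analysis"
begin

type_synonym pose = "(real ^ 3 ^ 3) \<times> (real ^ 3)"

type_synonym wrench = "real ^ 6"

definition pose_group :: "pose set" where
  "pose_group = {R. rotation_matrix R} \<times> UNIV"

definition positive_definite :: "real ^ 'n ^ 'n \<Rightarrow> bool" where
  "positive_definite A \<longleftrightarrow> transpose A = A \<and> (\<forall>v. v \<noteq> 0 \<longrightarrow> 0 < v \<bullet> (A *v v))"

text \<open>Only the indices \<open>1, \<dots>, num_poses B\<close> of the control and measurement families are meaningful.\<close>

record batch =
  num_poses :: nat
  control :: "nat \<Rightarrow> pose"
  measurement :: "nat \<Rightarrow> wrench"
  noise_cov :: "real ^ 6 ^ 6"

definition valid_batch :: "batch \<Rightarrow> bool" where
  "valid_batch B \<longleftrightarrow>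
     (\<forall>k\<in>{1..num_poses B}. control B k \<in> pose_group) \<and> positive_definite (noise_cov B)"

text \<open>The predicted wrench map \<open>h\<^sub>k\<close> at the control pose \<open>U\<^sub>k\<close> is \<open>h k U\<^sub>k\<close>. The explicit index
  \<open>k\<close> leaves the family \<open>h\<^sub>k\<close> arbitrary, even if a control pose occurs twice in the batch.\<close>

definition residual ::
  "(nat \<Rightarrow> pose \<Rightarrow> pose \<Rightarrow> wrench) \<Rightarrow> batch \<Rightarrow> nat \<Rightarrow> pose \<Rightarrow> wrench" where
  "residual h B k x = measurement B k - h k (control B k) x"

definition merit :: "(nat \<Rightarrow> pose \<Rightarrow> pose \<Rightarrow> wrench) \<Rightarrow> batch \<Rightarrow> pose \<Rightarrow> real" where
  "merit h B x =
     sqrt (\<Sum>k = 1..num_poses B. residual h B k x \<bullet> (matrix_inv (noise_cov B) *v residual h B k x))"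

text \<open>\<open>gen t x\<close> is the set of candidates generated at iteration \<open>t\<close> from the current pose \<open>x\<close>, and
  \<open>keep t x\<close> the set of those retained. The acceptance inequality is necessary for being retained;
  a rule may discard further candidates. Rules that depend on the history or on random choices are
  covered as well: a single run visits at most one
  pose at each \<open>t\<close>, so the sets that occur can be prescribed at the visited pairs \<open>(t, x)\<close> and
  be taken empty elsewhere.\<close>

definition residual_safeguarded ::
  "(pose \<Rightarrow> real) \<Rightarrow> real \<Rightarrow> (nat \<Rightarrow> pose \<Rightarrow> pose set) \<Rightarrow> (nat \<Rightarrow> pose \<Rightarrow> pose set) \<Rightarrow> bool" where
  "residual_safeguarded \<rho> \<epsilon> gen keep \<longleftrightarrow>
     (\<forall>t. \<forall>x\<in>pose_group.
        finite (gen t x) \<and> gen t x \<subseteq> pose_group \<and>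
        keep t x \<subseteq> {x' \<in> gen t x. \<rho> x' \<le> \<rho> x - \<epsilon>})"

text \<open>\<open>X t\<close> is the current pose at iteration \<open>t\<close>, and \<open>None\<close> once the loop has terminated. Since
  termination is not presupposed, a run may also go on forever.\<close>

definition refinement_run ::
  "(nat \<Rightarrow> pose \<Rightarrow> pose set) \<Rightarrow> pose \<Rightarrow> (nat \<Rightarrow> pose option) \<Rightarrow> bool" where
  "refinement_run keep x0 X \<longleftrightarrow>
     X 0 = Some x0 \<and>
     (\<forall>t. case X t of
            None \<Rightarrow> X (Suc t) = None
          | Some x \<Rightarrow> if keep t x = {} then X (Suc t) = None
                      else (\<exists>x'\<in>keep t x. X (Suc t) = Some x'))"

definition active :: "(nat \<Rightarrow> pose option) \<Rightarrow> nat set" where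
  "active X = {t. X t \<noteq> None}"

definition accepted_updates :: "(nat \<Rightarrow> pose option) \<Rightarrow> nat set" where
  "accepted_updates X = {t. t \<in> active X \<and> Suc t \<in> active X}"

definition strict_accepted_updates :: "(pose \<Rightarrow> real) \<Rightarrow> (nat \<Rightarrow> pose option) \<Rightarrow> nat set" where
  "strict_accepted_updates \<rho> X =
     {t \<in> accepted_updates X. \<rho> (the (X (Suc t))) < \<rho> (the (X t))}"

end

theory Submission
  imports Defs
begin

text \<open>Each accepted update lowers the merit by at least \<open>\<epsilon>\<close>, and the merit is nonnegative because
  the inverse of a positive definite covariance is positive semidefinite. Hence an update accepted
  at iteration \<open>t\<close> forces \<open>(t + 1) \<epsilon> \<le> \<rho> x0\<close>, which bounds the iterations at which updates occur.\<close>

text \<open>A nonzero kernel vector would make the quadratic form vanish, so the kernel is trivial;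
  for a square matrix this already gives invertibility.\<close>

lemma positive_definite_invertible:
  fixes A :: "real ^ 'n ^ 'n"
  assumes "positive_definite A"
  shows "invertible A"
proof -
  have "v = 0" if "A *v v = 0" for v
    using assms that unfolding positive_definite_def by (metis inner_zero_right less_irrefl)
  then show ?thesis
    by (meson invertible_left_inverse matrix_left_invertible_ker)
qed

lemma matrix_inv_right:
  fixes A :: "'a :: semiring_1 ^ 'n ^ 'm"
  assumes "invertible A"
  shows "A ** matrix_inv A = mat 1"
  using assms unfolding invertible_def matrix_inv_def by (rule someI2_ex) simp

text \<open>The substitution \<open>v = A *v w\<close> turns the form of the inverse at
  \<open>v\<close> into the form of \<open>A\<close> at \<open>w\<close>.\<close>

lemma positive_definite_matrix_inv_nonneg:
  fixes A :: "real ^ 'n ^ 'n"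
  assumes "positive_definite A"
  shows "0 \<le> v \<bullet> (matrix_inv A *v v)"
proof -
  define w where "w = matrix_inv A *v v"
  have "A *v w = v"
    using positive_definite_invertible[OF assms]
    by (simp add: w_def matrix_vector_mul_assoc matrix_inv_right)
  moreover have "0 \<le> w \<bullet> (A *v w)"
    using assms unfolding positive_definite_def by (cases "w = 0") (auto intro: less_imp_le)
  ultimately show ?thesis
    by (simp add: w_def inner_commute)
qed

text \<open>\<open>sqrt\<close> takes negative values at negative arguments, so the sum under the
  root has to be shown nonnegative; positive definiteness of the covariance enters here.\<close>

lemma merit_nonneg:
  assumes "valid_batch B"
  shows "0 \<le> merit h B x"
  using assms unfolding merit_def valid_batch_def
  by (simp add: positive_definite_matrix_inv_nonneg sum_nonneg)

text \<open>Reads the transition rule backwards: \<open>None\<close> is absorbing, so an active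
  iteration has an active predecessor.\<close>

lemma refinement_run_step:
  assumes "refinement_run keep x0 X" and "X (Suc t) = Some y"
  obtains x where "X t = Some x" and "y \<in> keep t x"
proof -
  have step: "case X t of
            None \<Rightarrow> X (Suc t) = None
          | Some x \<Rightarrow> if keep t x = {} then X (Suc t) = None
                      else (\<exists>x'\<in>keep t x. X (Suc t) = Some x')"
    using assms(1) unfolding refinement_run_def by blast
  show thesis
    using step assms(2) that by (cases "X t") (auto split: if_splits)
qed

text \<open>The acceptance inequality is available only at current poses in
  \<open>pose_group\<close>, so this invariant must be carried along the run first.\<close>

lemma refinement_run_in_pose_group:
  assumes "residual_safeguarded \<rho> \<epsilon> gen keep" and "refinement_run keep x0 X"
    and "x0 \<in> pose_group" and "X t = Some x"
  shows "x \<in> pose_group"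
  using assms(4)
proof (induction t arbitrary: x)
  case 0
  then show ?case
    using assms(2,3) by (simp add: refinement_run_def)
next
  case (Suc t)
  then obtain y where "X t = Some y" "x \<in> keep t y"
    using refinement_run_step[OF assms(2)] by blast
  then show ?case
    using Suc.IH assms(1) unfolding residual_safeguarded_def by blast
qed

lemma refinement_run_decrease:
  assumes "residual_safeguarded \<rho> \<epsilon> gen keep" and "refinement_run keep x0 X"
    and "x0 \<in> pose_group" and "Suc t \<in> active X"
  shows "t \<in> active X" and "\<rho> (the (X (Suc t))) \<le> \<rho> (the (X t)) - \<epsilon>"
proof -
  obtain y where y: "X (Suc t) = Some y"
    using assms(4) by (auto simp: active_def)
  then obtain x where x: "X t = Some x" "y \<in> keep t x"
    using refinement_run_step[OF assms(2)] by blast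
  have "x \<in> pose_group"
    using refinement_run_in_pose_group[OF assms(1-3) x(1)] .
  then have "\<rho> y \<le> \<rho> x - \<epsilon>"
    using assms(1) x(2) unfolding residual_safeguarded_def by blast
  then show "t \<in> active X" and "\<rho> (the (X (Suc t))) \<le> \<rho> (the (X t)) - \<epsilon>"
    using x y by (auto simp: active_def)
qed

text \<open>Telescopes the one-step decrease. The free start \<open>s\<close> serves both uses:
  \<open>s = 0\<close> for counting, arbitrary \<open>s\<close> for monotonicity.\<close>

lemma refinement_run_total_decrease:
  assumes "residual_safeguarded \<rho> \<epsilon> gen keep" and "refinement_run keep x0 X"
    and "x0 \<in> pose_group" and "s \<le> t" and "t \<in> active X"
  shows "\<rho> (the (X t)) \<le> \<rho> (the (X s)) - real (t - s) * \<epsilon>"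
  using assms(4,5)
proof (induction t rule: dec_induct)
  case base
  then show ?case by simp
next
  case (step n)
  note decrease = refinement_run_decrease[OF assms(1-3) step.prems]
  have "\<rho> (the (X (Suc n))) \<le> \<rho> (the (X s)) - real (n - s) * \<epsilon> - \<epsilon>"
    using decrease(2) step.IH[OF decrease(1)] by linarith
  also have "\<dots> = \<rho> (the (X s)) - real (Suc n - s) * \<epsilon>"
    \<comment> \<open>The hypothesis \<open>s \<le> n\<close> keeps the truncated difference
      exact.\<close>
    using step.hyps by (simp add: Suc_diff_le algebra_simps)
  finally show ?case .
qed

theorem lemma5p1:
  fixes h :: "nat \<Rightarrow> pose \<Rightarrow> pose \<Rightarrow> wrench"
    and B :: batch
    and \<rho> :: "pose \<Rightarrow> real"
    and \<epsilon> :: real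
    and gen keep :: "nat \<Rightarrow> pose \<Rightarrow> pose set"
    and x0 :: pose
    and X :: "nat \<Rightarrow> pose option"
  assumes "valid_batch B"
    and "\<rho> = merit h B"
    and "0 \<le> \<epsilon>"
    and "x0 \<in> pose_group"
    and "residual_safeguarded \<rho> \<epsilon> gen keep"
    and "refinement_run keep x0 X"
  shows "(\<forall>t\<in>accepted_updates X. \<rho> (the (X (Suc t))) \<le> \<rho> (the (X t)) - \<epsilon>) \<and>
         (\<epsilon> = 0 \<longrightarrow> antimono_on (active X) (\<lambda>t. \<rho> (the (X t)))) \<and>
         (\<epsilon> > 0 \<longrightarrow> finite (strict_accepted_updates \<rho> X) \<and>
                   real (card (strict_accepted_updates \<rho> X)) \<le> \<rho> x0 / \<epsilon>)"
proof (intro conjI impI ballI)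
  note run = assms(5,6,4)
  show "\<rho> (the (X (Suc t))) \<le> \<rho> (the (X t)) - \<epsilon>" if "t \<in> accepted_updates X" for t
    using that refinement_run_decrease(2)[OF run] by (simp add: accepted_updates_def)
  show "antimono_on (active X) (\<lambda>t. \<rho> (the (X t)))" if "\<epsilon> = 0"
    using refinement_run_total_decrease[OF run] that by (auto intro!: monotone_onI)

  have X0: "the (X 0) = x0"
    using assms(6) by (simp add: refinement_run_def)
  have nonneg: "0 \<le> \<rho> x" for x
    using merit_nonneg[OF assms(1)] assms(2) by simp
  \<comment> \<open>Bounding the indices of the updates by \<open>N\<close> yields finiteness and
    the cardinality bound together.\<close>
  define N where "N = nat \<lfloor>\<rho> x0 / \<epsilon>\<rfloor>"
  have sub: "strict_accepted_updates \<rho> X \<subseteq> {..<N}" if "\<epsilon> > 0"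
  proof
    fix t
    assume "t \<in> strict_accepted_updates \<rho> X"
    then have "Suc t \<in> active X"
      by (simp add: strict_accepted_updates_def accepted_updates_def)
    \<comment> \<open>Update \<open>t\<close> produces pose \<open>Suc t\<close>, after
      \<open>Suc t\<close> decreases; counting from 0 thus gives \<open>t < N\<close> and not merely
      \<open>t \<le> N\<close>.\<close>
    then have "\<rho> (the (X (Suc t))) \<le> \<rho> x0 - real (Suc t) * \<epsilon>"
      using refinement_run_total_decrease[OF run, of 0 "Suc t"] X0 by simp
    then have "real (Suc t) * \<epsilon> \<le> \<rho> x0"
      using nonneg[of "the (X (Suc t))"] by linarith
    then have "real (Suc t) \<le> \<rho> x0 / \<epsilon>"
      using that by (simp add: pos_le_divide_eq)
    then have "Suc t \<le> N"
      unfolding N_def by (rule le_nat_floor)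
    then show "t \<in> {..<N}"
      by simp
  qed
  show "finite (strict_accepted_updates \<rho> X)" if "\<epsilon> > 0"
    using sub[OF that] finite_subset by blast
  show "real (card (strict_accepted_updates \<rho> X)) \<le> \<rho> x0 / \<epsilon>" if "\<epsilon> > 0"
  proof -
    have "card (strict_accepted_updates \<rho> X) \<le> N"
      using card_mono[OF _ sub[OF that]] by simp
    \<comment> \<open>Since \<open>nat\<close> sends negative integers to 0, this bound requires a
      nonnegative quotient.\<close>
    moreover have "real N \<le> \<rho> x0 / \<epsilon>"
      unfolding N_def using nonneg[of x0] that by (intro of_nat_floor) simp
    ultimately show ?thesis
      by linarith
  qed
qed

end
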